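(* Let $a$ and $b$ be positive odd integers with $\gcd(a,b)=1$, and for $p\in\mathbb{N}_0$ let $$T_p(a,b)=2\sum_{j=0}^{b-1}(-1)^j\,\overline{E}_p\!\left(\frac{aj}{b}\right)\overline{E}_1\!\left(\frac{j}{b}\right).$$ (1) If $p$ is an even positive integer, then $$ab^{p+1}T_p(a,b)+a^{p+1}b\,T_p(b,a)=2E_{p+1}(0)-ab\sum_{k=0}^{p-1}\binom{p}{k}b^{k}E_{k}(0)\,a^{p-k}E_{p-k}(0).$$ (2) If $p$ is an odd positive integer, then $$b^{p}T_p(a,b)-a^{p}T_p(b,a)=(a^p-b^p)E_p(0).$$
   Context: The Euler polynomials $E_k(x)$, $k\in\mathbb{N}_0$, are defined by $\frac{2e^{xt}}{e^t+1}=\sum_{k=0}^\infty E_k(x)\frac{t^k}{k!}$. The quasi-periodic Euler function is $\overline{E}_k(x)=(-1)^{[x]}E_k(\{x\})$ for real $x$, where $[x]$ is the greatest integer not exceeding $x$ and $\{x\}=x-[x]$; equivalently $\overline{E}_k(x)=E_k(x)$ for $0\le x<1$ and $\overline{E}_k(x+1)=-\overline{E}_k(x)$. *)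

theory Defs
  imports "HOL-Analysis.Analysis" "HOL-Computational_Algebra.Computational_Algebra"
begin

text \<open>The generating function is read as a formal power series in t, for each fixed real x;
  the quotient is a power series because the denominator has constant term 2.\<close>

definition euler_poly :: "nat \<Rightarrow> real \<Rightarrow> real" where
  "euler_poly k x = fact k * fps_nth (fps_const 2 * fps_exp x / (fps_exp 1 + 1)) k"

lemma euler_poly_generating_function:
  "Abs_fps (\<lambda>k. euler_poly k x / fact k) * (fps_exp 1 + 1) = fps_const 2 * fps_exp x"
proof -
  have "fps_nth (fps_exp (1::real) + 1) 0 \<noteq> 0" by simp
  then have "fps_exp (1::real) + 1 dvd fps_const 2 * fps_exp x"
    using fps_is_unit_iff unit_imp_dvd by blast
  moreover have "Abs_fps (\<lambda>k. euler_poly k x / fact k) = fps_const 2 * fps_exp x / (fps_exp 1 + 1)"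
    by (rule fps_ext) (simp add: euler_poly_def)
  ultimately show ?thesis by simp
qed

definition quasi_euler :: "nat \<Rightarrow> real \<Rightarrow> real" where
  "quasi_euler k x = (-1) powi \<lfloor>x\<rfloor> * euler_poly k (frac x)"

lemma quasi_euler_unit_interval: "0 \<le> x \<Longrightarrow> x < 1 \<Longrightarrow> quasi_euler k x = euler_poly k x"
proof -
  assume "0 \<le> x" "x < 1"
  then have "\<lfloor>x\<rfloor> = 0" by linarith
  then show ?thesis by (simp add: quasi_euler_def frac_def)
qed

lemma quasi_euler_plus_one: "quasi_euler k (x + 1) = - quasi_euler k x"
  by (simp add: quasi_euler_def frac_def power_int_add)

definition T_sum :: "nat \<Rightarrow> nat \<Rightarrow> nat \<Rightarrow> real" where
  "T_sum p a b = 2 * (\<Sum>j = 0..<b. (-1) ^ j * quasi_euler p (real (a * j) / real b)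
                                        * quasi_euler 1 (real j / real b))"

end

theory Submission
  imports Defs "HOL-Number_Theory.Cong"
begin

text \<open>Put \<open>x = - e\<^sup>t\<close>. For odd \<open>a, b\<close> and \<open>r = a j mod b\<close>, the sign \<open>(-1)\<^sup>j\<close> combines with the
  quasi-period of the Euler function to \<open>(-1)\<^sup>r\<close>, so \<open>\<Sum>\<^sub>p b\<^sup>p T\<^sub>p(a,b) t\<^sup>p / p!\<close> is a rational function
  of \<open>x\<close>. The sum of the two such functions for \<open>(a,b)\<close> and \<open>(b,a)\<close> is evaluated by the
  generating function of Popoviciu's formula for the number of \<open>i, k \<ge> 0\<close> with
  \<open>n = a i + b k\<close>; this gives a reciprocity law for every \<open>p\<close>, which is (1) when \<open>p > 0\<close> is even since
  then \<open>E\<^sub>p(0) = 0\<close>. For odd \<open>p\<close> the reflection \<open>j \<mapsto> b - j\<close> cancels all terms but \<open>j = 0\<close>, so that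
  \<open>T\<^sub>p(a,b) = - E\<^sub>p(0)\<close>.\<close>

section \<open>Permutations of residue systems\<close>

lemma bij_betw_mult_mod:
  fixes a n :: nat
  assumes "coprime a n"
  shows "bij_betw (\<lambda>j. a * j mod n) {..<n} {..<n}"
proof -
  have "inj_on (\<lambda>j. a * j mod n) {..<n}"
  proof (rule inj_onI)
    fix i j assume "i \<in> {..<n}" "j \<in> {..<n}" "a * i mod n = a * j mod n"
    then show "i = j"
      using assms cong_mult_lcancel_nat[of a n i j] by (simp add: cong_def)
  qed
  moreover have "(\<lambda>j. a * j mod n) ` {..<n} \<subseteq> {..<n}"
    by force
  ultimately show ?thesis
    by (simp add: bij_betw_def endo_inj_surj)
qed

lemma bij_betw_add_mod:
  fixes q n :: nat
  shows "bij_betw (\<lambda>j. (q + j) mod n) {..<n} {..<n}"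
proof -
  have "inj_on (\<lambda>j. (q + j) mod n) {..<n}"
  proof (rule inj_onI)
    fix i j assume "i \<in> {..<n}" "j \<in> {..<n}" "(q + i) mod n = (q + j) mod n"
    then show "i = j"
      using cong_add_lcancel_nat[of q i j n] by (simp add: cong_def)
  qed
  moreover have "(\<lambda>j. (q + j) mod n) ` {..<n} \<subseteq> {..<n}"
    by force
  ultimately show ?thesis
    by (simp add: bij_betw_def endo_inj_surj)
qed

text \<open>Reducing modulo \<open>b\<close> kills \<open>b * k\<close>, and \<open>a\<close> is
  invertible modulo \<open>b\<close>, so the value determines \<open>i\<close>; symmetrically it
  determines \<open>k\<close>. Equal cardinalities turn injectivity into bijectivity.\<close>

lemma bij_betw_chinese_remainder:
  fixes a b :: nat
  assumes "coprime a b"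
  shows "bij_betw (\<lambda>(i, k). (a * i + b * k) mod (a * b)) ({..<b} \<times> {..<a}) {..<a * b}"
proof -
  let ?f = "\<lambda>(i, k). (a * i + b * k) mod (a * b)"
  have "inj_on ?f ({..<b} \<times> {..<a})"
  proof (rule inj_onI)
    fix s t assume st: "s \<in> {..<b} \<times> {..<a}" "t \<in> {..<b} \<times> {..<a}" "?f s = ?f t"
    obtain i k i' k' where s: "s = (i, k)" and t: "t = (i', k')"
      by (cases s, cases t)
    have *: "i \<in> {..<b}" "k \<in> {..<a}" "i' \<in> {..<b}" "k' \<in> {..<a}"
      and eq: "(a * i + b * k) mod (a * b) = (a * i' + b * k') mod (a * b)"
      using st by (auto simp: s t)
    have "(a * i + b * k) mod b = (a * i' + b * k') mod b"
      using arg_cong[OF eq, of "\<lambda>z. z mod b"] by (simp add: mod_mod_cancel)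
    then have "[a * i = a * i'] (mod b)"
      by (simp add: cong_def)
    then have "i = i'"
      using * inj_onD[OF bij_betw_imp_inj_on[OF bij_betw_mult_mod[OF assms]], of i i']
      by (simp add: cong_def)
    moreover have "(a * i + b * k) mod a = (a * i' + b * k') mod a"
      using arg_cong[OF eq, of "\<lambda>z. z mod a"] by (simp add: mod_mod_cancel)
    then have "[b * k = b * k'] (mod a)"
      by (simp add: cong_def)
    then have "k = k'"
      using * assms inj_onD[OF bij_betw_imp_inj_on[OF bij_betw_mult_mod[of b a]], of k k']
      by (simp add: cong_def coprime_commute)
    ultimately show "s = t" by (simp add: s t)
  qed
  moreover have "?f ` ({..<b} \<times> {..<a}) \<subseteq> {..<a * b}"
    by (auto intro!: mod_less_divisor)
  moreover have "card ({..<b} \<times> {..<a}) = card {..<a * b}"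
    by (simp add: mult.commute)
  ultimately show ?thesis
    unfolding bij_betw_def by (metis card_image card_subset_eq finite_lessThan)
qed

section \<open>Geometric sums and Popoviciu's identity\<close>

lemma sum_index_power:
  fixes x :: "'a :: comm_ring_1"
  shows "(1 - x) ^ 2 * (\<Sum>m<n. of_nat m * x ^ m) = x * (1 - x ^ n) - of_nat n * x ^ n * (1 - x)"
proof (induction n)
  case (Suc n)
  show ?case
    unfolding sum.lessThan_Suc distrib_left Suc.IH by (simp add: algebra_simps power2_eq_square)
qed simp

text \<open>Here \<open>t\<close> stands for \<open>1 / (1 - x ^ c)\<close>. Reciprocals enter as
  hypotheses so that the identities apply in the ring of formal power series, which is not a
  field.\<close>

lemma sum_power_mult_inverse:
  fixes x t :: "'a :: comm_ring_1"
  assumes "(1 - x ^ c) * t = 1"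
  shows "(\<Sum>i<n. (x ^ c) ^ i) = (1 - x ^ (c * n)) * t"
proof -
  have "1 - x ^ (c * n) = (1 - x ^ c) * (\<Sum>i<n. (x ^ c) ^ i)"
    using one_diff_power_eq[of "x ^ c" n] by (simp only: power_mult)
  then have "(1 - x ^ (c * n)) * t = ((1 - x ^ c) * t) * (\<Sum>i<n. (x ^ c) ^ i)"
    by (simp add: mult_ac)
  then show ?thesis using assms by simp
qed

text \<open>For fixed \<open>i\<close> the exponents run through all \<open>m < a * b\<close>
  congruent to \<open>a * i\<close> modulo \<open>b\<close>. The inner sum is thus
  \<open>x ^ (a * i mod b)\<close> times a geometric sum in \<open>x ^ b\<close> that does not
  depend on \<open>i\<close>.\<close>

lemma sum_residue_power:
  fixes x v :: "'a :: comm_ring_1"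
  assumes v: "(1 - x ^ b) * v = 1"
  shows "(\<Sum>i<b. \<Sum>k<a. of_nat i * x ^ ((a * i + b * k) mod (a * b)))
         = (1 - x ^ (a * b)) * v * (\<Sum>j<b. of_nat j * x ^ (a * j mod b))"
proof -
  have geo: "(\<Sum>k<a. (x ^ b) ^ k) = (1 - x ^ (a * b)) * v"
    using sum_power_mult_inverse[OF v] by (simp add: mult.commute)
  have "(\<Sum>k<a. x ^ ((a * i + b * k) mod (a * b))) = x ^ (a * i mod b) * ((1 - x ^ (a * b)) * v)"
    if "i < b" for i
  proof -
    \<comment> \<open>With the modulus ordered as \<open>b * a\<close>, \<open>mod_mult2_eq\<close>
      splits off the residue modulo \<open>b\<close>; what remains is \<open>k\<close> shifted
      cyclically modulo \<open>a\<close>.\<close>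
    have "(a * i + b * k) mod (b * a) = a * i mod b + b * ((a * i div b + k) mod a)" for k
      using that by (simp add: mod_mult2_eq add.commute)
    then have "x ^ ((a * i + b * k) mod (a * b)) = x ^ (a * i mod b) * (x ^ b) ^ ((a * i div b + k) mod a)" for k
      by (subst mult.commute[of a b]) (simp only: power_add power_mult)
    then have "(\<Sum>k<a. x ^ ((a * i + b * k) mod (a * b)))
        = x ^ (a * i mod b) * (\<Sum>k<a. (x ^ b) ^ ((a * i div b + k) mod a))"
      by (simp add: sum_distrib_left)
    also have "(\<Sum>k<a. (x ^ b) ^ ((a * i div b + k) mod a)) = (\<Sum>k<a. (x ^ b) ^ k)"
      by (rule sum.reindex_bij_betw[OF bij_betw_add_mod])
    finally show ?thesis by (simp only: geo)
  qed
  then have "(\<Sum>i<b. \<Sum>k<a. of_nat i * x ^ ((a * i + b * k) mod (a * b)))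
      = (\<Sum>i<b. of_nat i * (x ^ (a * i mod b) * ((1 - x ^ (a * b)) * v)))"
    by (intro sum.cong refl) (simp only: lessThan_iff flip: sum_distrib_left)
  also have "\<dots> = (1 - x ^ (a * b)) * v * (\<Sum>j<b. of_nat j * x ^ (a * j mod b))"
    unfolding sum_distrib_left by (simp only: mult_ac)
  finally show ?thesis .
qed

text \<open>Write \<open>a i + b k = m + a b e\<close> with \<open>m < a b\<close>, \<open>e \<in> {0, 1}\<close>. By the Chinese remainder theorem
  \<open>m\<close> runs once through the residues modulo \<open>a b\<close>, and \<open>a b e = a i + b k - m\<close> is linear in \<open>i\<close>, \<open>k\<close>
  and \<open>m\<close>. Summing \<open>a b x\<^bsup>a i + b k\<^esup>\<close> over \<open>i < b\<close>, \<open>k < a\<close> gives the identity.\<close>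

lemma popoviciu_identity:
  fixes x u v w :: "'a :: idom"
  assumes "coprime a b" and w: "(1 - x) * w = 1"
    and u: "(1 - x ^ a) * u = 1" and v: "(1 - x ^ b) * v = 1" and y: "x ^ (a * b) \<noteq> 1"
  shows "of_nat a * v * (\<Sum>j<b. of_nat j * x ^ (a * j mod b))
       + of_nat b * u * (\<Sum>j<a. of_nat j * x ^ (b * j mod a))
       + of_nat (a * b) * u * v = of_nat (a * b) * w + x * w\<^sup>2"
proof -
  define y where "y = x ^ (a * b)"
  define Sb where "Sb = (\<Sum>j<b. of_nat j * x ^ (a * j mod b))"
  define Sa where "Sa = (\<Sum>j<a. of_nat j * x ^ (b * j mod a))"
  define M where "M = (\<lambda>(i, k). (a * i + b * k) mod (a * b))"
  define P where "P = {..<b} \<times> {..<a}"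
  have reindex: "(\<Sum>z\<in>P. g (M z)) = (\<Sum>m<a * b. g m)" for g :: "nat \<Rightarrow> 'a"
    unfolding P_def M_def using sum.reindex_bij_betw[OF bij_betw_chinese_remainder[OF assms(1)], of g] .
  have split: "of_nat (a * b) * x ^ (a * i + b * k) = of_nat (a * b) * x ^ M (i, k)
      + (y - 1) * (of_nat (a * i) * x ^ M (i, k) + of_nat (b * k) * x ^ M (i, k)
                   - of_nat (M (i, k)) * x ^ M (i, k))" if "(i, k) \<in> P" for i k
  proof -
    define e where "e = (a * i + b * k) div (a * b)"
    have z: "a * i + b * k = a * b * e + M (i, k)"
      by (simp add: e_def M_def)
    have ik: "i < b" "k < a" using that by (auto simp: P_def)
    then have "a * i < a * b" "b * k < a * b" by auto
    then have "a * i + b * k < 2 * (a * b)" by linarith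
    then have "e < 2" unfolding e_def by (simp add: less_mult_imp_div_less)
    then have "e = 0 \<or> e = 1" by auto
    \<comment> \<open>Since \<open>e\<close> is 0 or 1, \<open>y ^ e\<close> is affine in
      \<open>e\<close>, so \<open>e\<close> can be replaced by its linear expression in
      \<open>i\<close>, \<open>k\<close> and \<open>M (i, k)\<close>.\<close>
    then have pow: "x ^ (a * b * e) = 1 + of_nat e * (y - 1)"
      by (auto simp: y_def)
    have "of_nat (a * b) * of_nat e = of_nat (a * i) + of_nat (b * k) - (of_nat (M (i, k)) :: 'a)"
      using arg_cong[OF z, of "of_nat :: nat \<Rightarrow> 'a"] by (simp add: algebra_simps)
    moreover have "of_nat (a * b) * x ^ (a * i + b * k)
        = of_nat (a * b) * x ^ M (i, k) + (y - 1) * ((of_nat (a * b) * of_nat e) * x ^ M (i, k))"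
      unfolding z power_add pow by (simp add: algebra_simps)
    ultimately show ?thesis by (simp add: left_diff_distrib distrib_right)
  qed
  have sum_i: "(\<Sum>(i, k)\<in>P. of_nat i * x ^ M (i, k)) = (1 - y) * v * Sb"
    unfolding P_def M_def y_def Sb_def
    using sum_residue_power[OF v] by (simp add: sum.cartesian_product)
  have sum_k: "(\<Sum>(i, k)\<in>P. of_nat k * x ^ M (i, k)) = (1 - y) * u * Sa"
  proof -
    have "(\<Sum>(i, k)\<in>P. of_nat k * x ^ M (i, k)) = (\<Sum>i<b. \<Sum>k<a. of_nat k * x ^ M (i, k))"
      by (simp add: P_def sum.cartesian_product)
    also have "\<dots> = (\<Sum>k<a. \<Sum>i<b. of_nat k * x ^ ((b * k + a * i) mod (b * a)))"
      by (subst sum.swap) (simp add: M_def add.commute mult.commute)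
    also have "\<dots> = (1 - y) * u * Sa"
      using sum_residue_power[OF u, of b] by (simp add: y_def Sa_def mult.commute)
    finally show ?thesis .
  qed
  have sum_pow: "(\<Sum>(i, k)\<in>P. x ^ (a * i + b * k)) = (1 - y) ^ 2 * u * v"
  proof -
    have "(\<Sum>(i, k)\<in>P. x ^ (a * i + b * k)) = (\<Sum>i<b. (x ^ a) ^ i) * (\<Sum>k<a. (x ^ b) ^ k)"
      by (simp add: P_def sum_product power_add power_mult flip: sum.cartesian_product)
    also have "\<dots> = (1 - y) ^ 2 * u * v"
      by (simp only: sum_power_mult_inverse[OF u] sum_power_mult_inverse[OF v]) (simp add: y_def power2_eq_square mult_ac)
    finally show ?thesis .
  qed
  have sum_m: "(\<Sum>m<a * b. x ^ m) = (1 - y) * w"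
    using sum_power_mult_inverse[of x 1 w "a * b"] w by (simp add: y_def)
  have sum_mm: "(\<Sum>m<a * b. of_nat m * x ^ m) = x * (1 - y) * w ^ 2 - of_nat (a * b) * y * w"
    (is "?s = _")
  proof -
    have "?s = ((1 - x) * w) ^ 2 * ?s" using w by simp
    also have "\<dots> = w ^ 2 * ((1 - x) ^ 2 * ?s)" by (simp add: power_mult_distrib mult_ac)
    also have "\<dots> = w ^ 2 * (x * (1 - y)) - of_nat (a * b) * y * w * ((1 - x) * w)"
      unfolding sum_index_power y_def by (simp add: algebra_simps power2_eq_square)
    finally show ?thesis using w by (simp add: mult_ac)
  qed
  have "of_nat (a * b) * ((1 - y) ^ 2 * u * v) = (\<Sum>(i, k)\<in>P. of_nat (a * b) * x ^ (a * i + b * k))"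
    by (simp add: case_prod_unfold flip: sum_pow sum_distrib_left)
  also have "\<dots> = (\<Sum>(i, k)\<in>P. of_nat (a * b) * x ^ M (i, k)
      + (y - 1) * (of_nat a * (of_nat i * x ^ M (i, k)) + of_nat b * (of_nat k * x ^ M (i, k))
                   - of_nat (M (i, k)) * x ^ M (i, k)))"
    by (intro sum.cong refl) (clarify, simp only: split, simp add: mult_ac)
  also have "\<dots> = of_nat (a * b) * (\<Sum>z\<in>P. x ^ M z)
      + (y - 1) * (of_nat a * (\<Sum>(i, k)\<in>P. of_nat i * x ^ M (i, k))
        + of_nat b * (\<Sum>(i, k)\<in>P. of_nat k * x ^ M (i, k)) - (\<Sum>z\<in>P. of_nat (M z) * x ^ M z))"
    by (simp add: case_prod_unfold sum.distrib sum_subtractf flip: sum_distrib_left)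
  also have "\<dots> = of_nat (a * b) * ((1 - y) * w)
      + (y - 1) * (of_nat a * ((1 - y) * v * Sb) + of_nat b * ((1 - y) * u * Sa)
                   - (x * (1 - y) * w ^ 2 - of_nat (a * b) * y * w))"
    by (simp only: sum_i sum_k reindex[of "\<lambda>m. x ^ m"] reindex[of "\<lambda>m. of_nat m * x ^ m"] sum_m sum_mm)
  \<comment> \<open>The term \<open>of_nat (a * b) * y * w\<close> from \<open>sum_mm\<close>
    combines with \<open>of_nat (a * b) * ((1 - y) * w)\<close>, so that every term carries
    \<open>(1 - y) ^ 2\<close>, which is then cancelled.\<close>
  finally have "(1 - y) ^ 2 * (of_nat a * v * Sb + of_nat b * u * Sa + of_nat (a * b) * u * v)
      = (1 - y) ^ 2 * (of_nat (a * b) * w + x * w\<^sup>2)"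
    by algebra
  moreover have "(1 - y) ^ 2 \<noteq> 0" using y by (simp add: y_def)
  ultimately show ?thesis unfolding Sa_def Sb_def by simp
qed


section \<open>Generating function and values of the Euler polynomials\<close>

text \<open>Rescale \<open>t\<close> to \<open>c t\<close> in the generating function. With
  \<open>c = b\<close> this clears the denominator of an argument \<open>r / b\<close>; with
  \<open>c = -1\<close> it yields the reflection formula.\<close>

lemma power_mult_euler_poly:
  "c ^ k * euler_poly k x = fact k * fps_nth (fps_const 2 * fps_exp (c * x) * inverse (1 + fps_exp c)) k"
proof -
  have "Abs_fps (\<lambda>k. euler_poly k x / fact k) = fps_const 2 * fps_exp x * inverse (1 + fps_exp 1)"
  proof -
    have inv: "(fps_exp 1 + 1) * inverse (1 + fps_exp (1::real)) = 1"
      using inverse_mult_eq_1'[of "1 + fps_exp (1::real)"] by (simp add: add.commute)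
    have "Abs_fps (\<lambda>k. euler_poly k x / fact k)
        = Abs_fps (\<lambda>k. euler_poly k x / fact k) * ((fps_exp 1 + 1) * inverse (1 + fps_exp 1))"
      by (simp only: inv mult_1_right)
    then show ?thesis
      by (simp only: euler_poly_generating_function flip: mult.assoc)
  qed
  then have "Abs_fps (\<lambda>k. euler_poly k x / fact k) oo (fps_const c * fps_X)
      = fps_const 2 * fps_exp (c * x) * inverse (1 + fps_exp c)"
    by (simp add: fps_compose_mult_distrib fps_inverse_compose fps_compose_add_distrib)
  from arg_cong[OF this, of "\<lambda>f. fact k * fps_nth f k"] show ?thesis
    by simp
qed

text \<open>Multiplying numerator and denominator of \<open>e^((1 - x) t) / (1 + e^t)\<close> by
  \<open>e^(-t)\<close> gives \<open>e^(-x t) / (1 + e^(-t))\<close>, the same function at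
  \<open>-t\<close>.\<close>

lemma euler_poly_reflect: "euler_poly k (1 - x) = (-1) ^ k * euler_poly k x"
proof -
  have e: "fps_exp 1 * fps_exp (- 1) = (1 :: real fps)"
    by (simp flip: fps_exp_add_mult)
  then have "fps_exp 1 * (1 + fps_exp (- 1)) = (1 + fps_exp 1 :: real fps)"
    by (simp add: distrib_left)
  then have "fps_exp 1 * inverse (1 + fps_exp 1) = inverse (1 + fps_exp (- 1) :: real fps)"
    by (metis e fps_exp_neg fps_inverse_mult mult.left_commute mult.right_neutral)
  moreover have "fps_exp (1 - x) = fps_exp 1 * fps_exp (- x)"
    by (simp flip: fps_exp_add_mult)
  ultimately have "fps_exp (1 - x) * inverse (1 + fps_exp 1) = fps_exp (- x) * inverse (1 + fps_exp (- 1))"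
    by (simp add: mult_ac)
  then show ?thesis
    using power_mult_euler_poly[of 1 k "1 - x"] power_mult_euler_poly[of "- 1" k x]
    by (simp only: power_one mult_1 mult_minus1 mult.assoc)
qed

text \<open>The generating functions at 1 and 0 add up to the constant 2, so the two values are
  opposite for \<open>p > 0\<close>; reflection makes them equal for even \<open>p\<close>.\<close>

lemma euler_poly_0_even:
  assumes "even p" "p > 0"
  shows "euler_poly p 0 = 0"
proof -
  have "euler_poly p 1 / fact p + euler_poly p 0 / fact p = 0"
  proof -
    have "fps_exp 1 * inverse (1 + fps_exp 1) + inverse (1 + fps_exp 1) = (1 :: real fps)"
      using inverse_mult_eq_1[of "1 + fps_exp (1::real)"] by (simp add: algebra_simps)
    from arg_cong[OF this, of "\<lambda>f. 2 * fps_nth f p"] show ?thesis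
      using power_mult_euler_poly[of 1 p 1] power_mult_euler_poly[of 1 p 0] assms(2)
      by (simp add: mult.assoc distrib_left)
  qed
  moreover have "euler_poly p 1 = euler_poly p 0"
    using euler_poly_reflect[of p 0] assms(1) by simp
  ultimately show ?thesis by simp
qed

lemma euler_poly_1: "euler_poly 1 x = x - 1 / 2"
proof -
  have "fps_nth (Abs_fps (\<lambda>k. euler_poly k x / fact k) * (fps_exp 1 + 1)) n
      = fps_nth (fps_const 2 * fps_exp x) n" for n
    by (simp only: euler_poly_generating_function)
  from this[of 0] this[of 1] show ?thesis
    by (simp add: fps_mult_nth)
qed

section \<open>The sum \<open>T_sum\<close> in terms of residues, and its value for odd
  \<open>p\<close>\<close>

lemma quasi_euler_fraction:
  assumes "odd a" "odd b"
  shows "(-1) ^ j * quasi_euler p (real (a * j) / real b)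
         = (-1) ^ (a * j mod b) * euler_poly p (real (a * j mod b) / real b)"
proof -
  define q r where "q = a * j div b" and "r = a * j mod b"
  have b: "b > 0" using assms by (cases b) auto
  have z: "a * j = b * q + r" by (simp add: q_def r_def)
  have fl: "\<lfloor>real (a * j) / real b\<rfloor> = int q"
    by (simp only: floor_divide_of_nat_eq q_def)
  have fr: "frac (real (a * j) / real b) = real r / real b"
    unfolding frac_def fl using b by (simp only: z) (simp add: field_simps)
  \<comment> \<open>Modulo 2 the odd factors drop out of \<open>a * j = b * q + r\<close>, leaving
    \<open>j\<close> congruent to \<open>q + r\<close>.\<close>
  have "even (j + q) \<longleftrightarrow> even r"
    using arg_cong[OF z, of even] assms by auto
  then have "(-1) ^ (j + q) = ((-1) ^ r :: real)"
    by (simp add: minus_one_power_iff)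
  then show ?thesis
    unfolding quasi_euler_def fl fr
    by (simp add: power_add mult.assoc flip: r_def)
qed

lemma T_sum_eq:
  assumes "odd a" "odd b"
  shows "T_sum p a b = (\<Sum>j<b. (-1) ^ (a * j mod b) * euler_poly p (real (a * j mod b) / real b)
                                 * (2 * real j / real b - 1))"
  unfolding T_sum_def sum_distrib_left quasi_euler_fraction[OF assms] atLeast0LessThan
proof (intro sum.cong refl)
  fix j assume "j \<in> {..<b}"
  then have "quasi_euler 1 (real j / real b) = euler_poly 1 (real j / real b)"
    by (intro quasi_euler_unit_interval) auto
  then have q: "2 * quasi_euler 1 (real j / real b) = 2 * real j / real b - 1"
    unfolding euler_poly_1 by simp
  show "2 * ((-1) ^ (a * j mod b) * euler_poly p (real (a * j mod b) / real b) * quasi_euler 1 (real j / real b))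
      = (-1) ^ (a * j mod b) * euler_poly p (real (a * j mod b) / real b) * (2 * real j / real b - 1)"
    unfolding q[symmetric] by (simp only: mult_ac)
qed

text \<open>Under \<open>j\<close> to \<open>b - j\<close> the residue \<open>r\<close> becomes
  \<open>b - r\<close>. The sign flips as \<open>b\<close> is odd, the Euler value as
  \<open>p\<close> is odd, and the linear factor always: three flips negate the term. At
  \<open>j = 0\<close> the linear factor is -1.\<close>

lemma T_sum_odd:
  assumes "odd a" "odd b" "coprime a b" "odd p"
  shows "T_sum p a b = - euler_poly p 0"
proof -
  define f where "f j = (-1) ^ (a * j mod b) * euler_poly p (real (a * j mod b) / real b)
                         * (2 * real j / real b - 1)" for j
  have b: "b > 0" using assms by (cases b) auto
  have reflect: "f (b - j) = - f j" if j: "j \<in> {1..<b}" for j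
  proof -
    define r where "r = a * j mod b"
    have "\<not> b dvd a * j"
      using j assms(3) by (auto simp: coprime_dvd_mult_right_iff coprime_commute dest: dvd_imp_le)
    then have r: "0 < r" "r < b" using b by (auto simp: r_def dvd_eq_mod_eq_0)
    have "(a * (b - j) mod b + r) mod b = (a * (b - j) + a * j) mod b"
      by (simp add: r_def mod_simps)
    also have "a * (b - j) + a * j = a * b"
      using j by (simp flip: distrib_left)
    finally have "b dvd a * (b - j) mod b + r" by (simp add: dvd_eq_mod_eq_0)
    then obtain c where c: "a * (b - j) mod b + r = b * c" ..
    \<comment> \<open>Two residues, one of them positive, add up to a positive multiple of
      \<open>b\<close> below \<open>2 * b\<close>, hence to \<open>b\<close>.\<close>
    have "b * c < b * 2" unfolding c[symmetric] using r mod_less_divisor[OF b, of "a * (b - j)"] by linarith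
    moreover have "c \<noteq> 0" using c r by (intro notI) simp
    ultimately have "c = 1" by simp
    then have r': "a * (b - j) mod b = b - r" using c by simp
    have e: "(-1) ^ (b - r) = - ((-1) ^ r :: real)"
      using r assms(2) by (auto simp: minus_one_power_iff)
    have d: "real (b - r) / real b = 1 - real r / real b" "2 * real (b - j) / real b - 1 = - (2 * real j / real b - 1)"
      using r j b by (auto simp: of_nat_diff field_simps)
    show ?thesis
      unfolding f_def r' r_def[symmetric] d e euler_poly_reflect using assms(4) by (simp add: algebra_simps)
  qed
  have "sum f {1..<b} = (\<Sum>j\<in>{1..<b}. f (b - j))"
    by (rule sum.reindex_bij_witness[of _ "\<lambda>j. b - j" "\<lambda>j. b - j"]) auto
  also have "\<dots> = - sum f {1..<b}"
    by (simp add: reflect sum_negf)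
  finally have "sum f {1..<b} = 0" by simp
  moreover have "{..<b} = insert 0 {1..<b}" using b by auto
  ultimately show ?thesis
    unfolding T_sum_eq[OF assms(1,2)] f_def[symmetric] by (simp add: f_def)
qed

section \<open>Generating function of \<open>T_sum\<close> and reciprocity\<close>

lemma neg_fps_exp_power: "(- fps_exp (1::real)) ^ n = fps_const ((-1) ^ n) * fps_exp (real n)"
  by (cases "even n") (simp_all add: fps_exp_power_mult flip: fps_const_neg)

text \<open>As \<open>b\<close> is odd, \<open>v\<close> is \<open>1 / (1 + e^(b t))\<close>, so
  each scaled Euler value is a coefficient of \<open>2 v x^r\<close> up to \<open>fact p\<close>. In
  the weight \<open>2 j / b - 1\<close>, the part linear in \<open>j\<close> gives the sum in
  Popoviciu's identity and the constant part gives \<open>w\<close>.\<close>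

lemma T_sum_generating_function:
  fixes x v w :: "real fps"
  assumes "odd a" "odd b" "coprime a b" and x: "x = - fps_exp 1"
    and w: "(1 - x) * w = 1" and v: "(1 - x ^ b) * v = 1"
  shows "real b ^ p * T_sum p a b = fact p * fps_nth
    (fps_const (4 / real b) * v * (\<Sum>j<b. of_nat j * x ^ (a * j mod b)) - fps_const 2 * w) p"
proof -
  have b: "b > 0" using assms by (cases b) auto
  have xb: "1 - x ^ b = 1 + fps_exp (real b)"
    using assms(2) by (simp add: x neg_fps_exp_power flip: fps_const_neg)
  have v': "v = inverse (1 + fps_exp (real b))"
    using v unfolding xb by (metis fps_inverse_unique mult.commute)
  have "real b ^ p * ((-1) ^ r * euler_poly p (real r / real b) * c)
      = fact p * fps_nth (fps_const (2 * c) * v * x ^ r) p" for r c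
  proof -
    have "real b ^ p * ((-1) ^ r * euler_poly p (real r / real b) * c)
        = ((-1) ^ r * c) * (real b ^ p * euler_poly p (real r / real b))" by simp
    also have "\<dots> = fact p * fps_nth (fps_const ((-1) ^ r * c) * (fps_const 2 * fps_exp (real r) * v)) p"
      using b by (simp only: power_mult_euler_poly v' fps_mult_left_const_nth) (simp add: mult_ac)
    also have "fps_const ((-1) ^ r * c) * (fps_const 2 * fps_exp (real r) * v) = fps_const (2 * c) * v * x ^ r"
      by (simp add: x neg_fps_exp_power mult_ac flip: fps_const_mult)
    finally show ?thesis .
  qed
  then have "real b ^ p * T_sum p a b
      = fact p * fps_nth (\<Sum>j<b. fps_const (2 * (2 * real j / real b - 1)) * v * x ^ (a * j mod b)) p"
    by (simp only: T_sum_eq[OF assms(1,2)] sum_distrib_left fps_sum_nth)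
  also have "(\<Sum>j<b. fps_const (2 * (2 * real j / real b - 1)) * v * x ^ (a * j mod b))
      = (\<Sum>j<b. fps_const (4 / real b) * v * (of_nat j * x ^ (a * j mod b)) - fps_const 2 * v * x ^ (a * j mod b))"
  proof (intro sum.cong refl)
    fix j
    have "fps_const (2 * (2 * real j / real b - 1)) = fps_const (4 / real b) * of_nat j - fps_const 2"
      by (simp add: fps_of_nat[symmetric] field_simps)
    then show "fps_const (2 * (2 * real j / real b - 1)) * v * x ^ (a * j mod b)
      = fps_const (4 / real b) * v * (of_nat j * x ^ (a * j mod b)) - fps_const 2 * v * x ^ (a * j mod b)"
      by (simp only:) (simp add: algebra_simps)
  qed
  also have "\<dots> = fps_const (4 / real b) * v * (\<Sum>j<b. of_nat j * x ^ (a * j mod b))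
      - fps_const 2 * v * (\<Sum>j<b. x ^ (a * j mod b))"
    by (simp only: sum_subtractf sum_distrib_left)
  \<comment> \<open>Without the weight \<open>j\<close> the permutation of residues is invisible,
    and the geometric sum cancels the denominator \<open>v\<close>.\<close>
  also have "(\<Sum>j<b. x ^ (a * j mod b)) = (\<Sum>j<b. x ^ j)"
    by (rule sum.reindex_bij_betw[OF bij_betw_mult_mod[OF assms(3)]])
  also have "\<dots> = (1 - x ^ b) * w"
    using sum_power_mult_inverse[of x 1 w b] w by simp
  also have "fps_const 2 * v * ((1 - x ^ b) * w) = fps_const 2 * w"
    using v by (simp add: mult_ac)
  finally show ?thesis .
qed

text \<open>Popoviciu's identity is multiplied by \<open>4 / (a b)\<close>. Its \<open>w\<close>
  term becomes \<open>4 w\<close> and cancels against the two summands \<open>- 2 w\<close>, the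
  product \<open>u * v\<close> becomes the convolution, and \<open>x * w^2\<close> becomes the term
  with \<open>p + 1\<close>.\<close>

lemma T_sum_reciprocity:
  assumes "odd a" "odd b" "coprime a b"
  shows "real b ^ p * T_sum p a b + real a ^ p * T_sum p b a
     = 2 * euler_poly (p + 1) 0 / (real a * real b)
       - (\<Sum>k = 0..p. real (p choose k) * real b ^ k * euler_poly k 0 * real a ^ (p - k) * euler_poly (p - k) 0)"
proof -
  define x where "x = - fps_exp (1::real)"
  define W where "W c = inverse (1 + fps_exp c)" for c :: real
  have W: "(1 - x ^ n) * W (real n) = 1" if "odd n" for n
    unfolding W_def using that inverse_mult_eq_1'[of "1 + fps_exp (real n)"]
    by (simp add: x_def neg_fps_exp_power flip: fps_const_neg)
  have W1: "(1 - x) * W 1 = 1" using W[of 1] by simp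
  have ab: "real a \<noteq> 0" "real b \<noteq> 0" using assms by (auto intro: ccontr)
  have "x ^ (a * b) \<noteq> 1" using W[of "a * b"] assms by auto
  note pop = popoviciu_identity[OF assms(3) W1 W[OF assms(1)] W[OF assms(2)] this]
  define Sb where "Sb = (\<Sum>j<b. of_nat j * x ^ (a * j mod b))"
  define Sa where "Sa = (\<Sum>j<a. of_nat j * x ^ (b * j mod a))"
  have E: "fps_nth (W c) k = c ^ k * euler_poly k 0 / (2 * fact k)" for c k
    using power_mult_euler_poly[of c k 0] by (simp add: W_def)
  \<comment> \<open>This derivative raises the index to \<open>p + 1\<close>.\<close>
  have deriv: "fps_deriv (W 1) = x * (W 1)\<^sup>2"
    unfolding W_def x_def by (subst fps_inverse_deriv) simp_all
  have "fps_const (4 / real b) * W (real b) * Sb - fps_const 2 * W 1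
      + (fps_const (4 / real a) * W (real a) * Sa - fps_const 2 * W 1)
      = fps_const (4 / (real a * real b)) * (x * (W 1)\<^sup>2)
        - fps_const 4 * (W (real b) * W (real a))"
  proof -
    define c where "c = fps_const (4 / (real a * real b))"
    have "fps_const (4 / real b) = c * of_nat a" "fps_const (4 / real a) = c * of_nat b"
      and c: "fps_const 4 = c * of_nat (a * b)"
      using ab by (simp_all add: c_def fps_of_nat[symmetric])
    moreover have "fps_const 2 * W 1 + fps_const 2 * W 1 = c * of_nat (a * b) * W 1"
      unfolding c[symmetric] by (simp flip: distrib_right)
    ultimately show ?thesis
      using pop unfolding c c_def[symmetric] Sa_def[symmetric] Sb_def[symmetric] by algebra
  qed
  then have "real b ^ p * T_sum p a b + real a ^ p * T_sum p b a
     = fact p * fps_nth (fps_const (4 / (real a * real b)) * (x * (W 1)\<^sup>2) - fps_const 4 * (W (real b) * W (real a))) p"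
    using T_sum_generating_function[OF assms x_def W1 W[OF assms(2)], of p]
      T_sum_generating_function[OF assms(2,1) assms(3)[unfolded coprime_commute[of a]] x_def W1 W[OF assms(1)], of p]
    unfolding Sa_def[symmetric] Sb_def[symmetric] by (simp only: distrib_left[symmetric] fps_add_nth[symmetric])
  also have "\<dots> = 4 / (real a * real b) * (fact p * fps_nth (fps_deriv (W 1)) p) - fact p * (4 * fps_nth (W (real b) * W (real a)) p)"
    by (simp add: deriv right_diff_distrib)
  also have "fact p * fps_nth (fps_deriv (W 1)) p = euler_poly (p + 1) 0 / 2"
    by (simp add: E fps_deriv_nth)
  also have "fact p * (4 * fps_nth (W (real b) * W (real a)) p)
      = (\<Sum>k = 0..p. real (p choose k) * real b ^ k * euler_poly k 0 * real a ^ (p - k) * euler_poly (p - k) 0)"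
    unfolding fps_mult_nth sum_distrib_left E
    by (intro sum.cong refl) (simp add: binomial_fact field_simps)
  finally show ?thesis by simp
qed

theorem theorem1p1:
  fixes a b p :: nat
  assumes "a > 0" and "b > 0" and "odd a" and "odd b" and "coprime a b" and "p > 0"
  shows "(even p \<longrightarrow>
            real a * real b ^ (p + 1) * T_sum p a b + real a ^ (p + 1) * real b * T_sum p b a
              = 2 * euler_poly (p + 1) 0
                - real a * real b * (\<Sum>k = 0..p - 1. real (p choose k) * real b ^ k * euler_poly k 0
                                          * real a ^ (p - k) * euler_poly (p - k) 0))
       \<and> (odd p \<longrightarrow>
            real b ^ p * T_sum p a b - real a ^ p * T_sum p b a
              = (real a ^ p - real b ^ p) * euler_poly p 0)"
proof (intro conjI impI)
  assume "even p"
  let ?g = "\<lambda>k. real (p choose k) * real b ^ k * euler_poly k 0 * real a ^ (p - k) * euler_poly (p - k) 0"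
  \<comment> \<open>The last summand contains \<open>euler_poly p 0\<close>, which vanishes for even
    \<open>p > 0\<close>.\<close>
  have "sum ?g {0..p} = sum ?g {0..p - 1}"
    using sum.atLeast0_atMost_Suc[of ?g "p - 1"] euler_poly_0_even[OF \<open>even p\<close>] assms(6) by simp
  then show "real a * real b ^ (p + 1) * T_sum p a b + real a ^ (p + 1) * real b * T_sum p b a
      = 2 * euler_poly (p + 1) 0 - real a * real b * sum ?g {0..p - 1}"
    using arg_cong[OF T_sum_reciprocity[OF assms(3-5), of p], of "\<lambda>z. real a * real b * z"] assms(1,2)
    by (simp add: distrib_left right_diff_distrib mult_ac)
next
  assume "odd p"
  then show "real b ^ p * T_sum p a b - real a ^ p * T_sum p b a
      = (real a ^ p - real b ^ p) * euler_poly p 0"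
    using T_sum_odd[of a b p] T_sum_odd[of b a p] assms by (simp add: coprime_commute algebra_simps)
qed

end
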